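(* Let $k\in\mathbb{N}$, let $k_1=k+\frac12$ and let $u\ge 0$. Then, with $C_0=\sqrt{\pi}\operatorname{erf}(\frac{\pi}{2})$, $$\frac{C_0}{e\sqrt{8\pi k_1}}\,e^{-2u} \;\le\; e^{-k_1(2u+\sinh 2u)}\,\big\|\Pi_{\sqrt{2k_1}\sinh u,\,k}\big\| \;\le\; \sqrt{\frac{27}{e}}.$$
   Context: $\mathbb{N}=\{0,1,2,\dots\}$; $\operatorname{erf}(z)=\frac{2}{\sqrt\pi}\int_0^z e^{-t^2}\,dt$. The Hermite functions are $h_k(y) = (2^k k!\sqrt{\pi})^{-1/2}\left(y-\frac{d}{dy}\right)^k e^{-y^2/2}$, regarded as entire functions of $y$. For $a\in\mathbb{R}$ the shifted harmonic oscillator $P_a=\frac12(-\partial_y^2+(y-ia)^2-1)$ on $L^2(\mathbb{R})$ has compact resolvent and spectrum $\mathbb{N}$; its spectral projection at the eigenvalue $k\in\mathbb{N}$ is the rank-one operator $$\Pi_{a,k}f(y) = \langle f, h_k(\cdot+ia)\rangle_{L^2(\mathbb{R})}\, h_k(y-ia),\qquad \langle f,g\rangle=\int_{\mathbb{R}} f\bar g\,dy,$$ and $\|\Pi_{a,k}\|$ is its operator norm on $L^2(\mathbb{R})$. *)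

theory Defs
  imports "HOL-Analysis.Analysis"
begin

definition erf :: "real \<Rightarrow> real" where
  "erf z = 2 / sqrt pi * (LBINT t=0..z. exp (- (t\<^sup>2)))"

(* y - d/dy acting on entire functions; deriv is the complex derivative. *)
definition creation_op :: "(complex \<Rightarrow> complex) \<Rightarrow> complex \<Rightarrow> complex" where
  "creation_op f = (\<lambda>y. y * f y - deriv f y)"

definition hermite_fun :: "nat \<Rightarrow> complex \<Rightarrow> complex" where
  "hermite_fun k y =
     of_real ((2 ^ k * fact k * sqrt pi) powr (- 1 / 2)) *
     (creation_op ^^ k) (\<lambda>z. exp (- (z\<^sup>2) / 2)) y"

(* Elements of L^2(R) are handled through representatives: no quotient by equality almost
   everywhere is taken. L2_inner and L2_norm do not depend on the choice of representatives. *)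
definition L2_functions :: "(real \<Rightarrow> complex) set" where
  "L2_functions =
     {f. f \<in> borel_measurable lborel \<and> integrable lborel (\<lambda>y. (norm (f y))\<^sup>2)}"

definition L2_inner :: "(real \<Rightarrow> complex) \<Rightarrow> (real \<Rightarrow> complex) \<Rightarrow> complex" where
  "L2_inner f g = (LINT y|lborel. f y * cnj (g y))"

definition L2_norm :: "(real \<Rightarrow> complex) \<Rightarrow> real" where
  "L2_norm f = sqrt (LINT y|lborel. (norm (f y))\<^sup>2)"

(* As with onorm, this is meaningful only for operators that are bounded on L^2(R). The
   projections below are: they have rank one, and h_k(y + ia), h_k(y - ia) are polynomials
   in y times Gaussians, hence square integrable. *)
definition L2_opnorm :: "((real \<Rightarrow> complex) \<Rightarrow> real \<Rightarrow> complex) \<Rightarrow> real" where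
  "L2_opnorm T = (SUP f\<in>{f \<in> L2_functions. L2_norm f \<le> 1}. L2_norm (T f))"

(* The spectral projection, at the eigenvalue k, of the shifted harmonic oscillator
   P_a = (- d^2/dy^2 + (y - ia)^2 - 1) / 2 on L^2(R), given by its rank-one formula. *)
definition shifted_proj :: "real \<Rightarrow> nat \<Rightarrow> (real \<Rightarrow> complex) \<Rightarrow> real \<Rightarrow> complex" where
  "shifted_proj a k f =
     (\<lambda>y. L2_inner f (\<lambda>x. hermite_fun k (of_real x + \<i> * of_real a)) *
          hermite_fun k (of_real y - \<i> * of_real a))"

end

theory Submission
  imports Defs "HOL-Probability.Distributions"
begin

text \<open>Since \<open>h\<^sub>k(y - ia)\<close> is the complex conjugate of \<open>h\<^sub>k(y + ia)\<close> for real \<open>y\<close>, the norm of the rank-one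
  projection is the square integral of \<open>h\<^sub>k(y + ia)\<close>. Expanding the shifted Hermite polynomial and
  using orthogonality, this is \<open>exp(a\<^sup>2) L\<^sub>k(-2a\<^sup>2)\<close>, where the Laguerre polynomial \<open>L\<^sub>k(-x)\<close> is the sum of
  \<open>(k choose j) x\<^sup>j / j!\<close>. Bounding \<open>(k choose j) w\<^sup>j \<le> (1 + w)\<^sup>k\<close> with \<open>1 + w = exp(2u)\<close> gives the upper
  bound \<open>exp(-u)\<close>. Cauchy--Schwarz gives
  \<open>(p + q)\<^bsup>2k\<^esup> \<le> L\<^sub>k(-p\<^sup>2) k! exp(q\<^sup>2)\<close>; taking \<open>p = 2 \<surd>k\<^sub>1 sinh u\<close> and \<open>q = \<surd>k\<^sub>1 exp(-u)\<close>, so that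
  \<open>p + q = \<surd>k\<^sub>1 exp u\<close>, and estimating \<open>k!\<close> gives the lower bound \<open>exp(-u) / (e \<surd>k\<^sub>1)\<close>. The constant
  \<open>C\<^sub>0\<close> enters only through \<open>C\<^sub>0 \<le> \<pi> \<le> \<surd>(8\<pi>)\<close>.\<close>

section \<open>Hermite polynomials: recurrence, derivative and addition formula\<close>

text \<open>Physicists' normalisation. The coefficient ring is generic because orthogonality is used
  over the reals and the shift by \<open>\<i> * a\<close> over the complex numbers.\<close>

fun hermite_poly :: "nat \<Rightarrow> 'a::idom poly" where
  "hermite_poly 0 = 1"
| "hermite_poly (Suc 0) = [:0, 2:]"
| "hermite_poly (Suc (Suc n)) =
     [:0, 2:] * hermite_poly (Suc n) - smult (2 * of_nat (Suc n)) (hermite_poly n)"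

lemma pderiv_hermite_poly:
  "pderiv (hermite_poly n :: 'a::idom poly) = smult (2 * of_nat n) (hermite_poly (n - 1))"
proof (induction n rule: hermite_poly.induct)
  case 1
  show ?case by simp
next
  case 2
  show ?case by (simp add: pderiv_pCons)
next
  case (3 n)
  \<comment> \<open>The recurrence solved for its last term. It also covers n = 0, where the factor
    \<open>of_nat n\<close> cancels the truncated index \<open>n - 1\<close>.\<close>
  have *: "smult (2 * of_nat n :: 'a) (hermite_poly (n - 1)) = [:0, 2:] * hermite_poly n - hermite_poly (Suc n)"
    by (cases n) (simp_all add: algebra_simps)
  have "pderiv (hermite_poly (Suc (Suc n)) :: 'a poly) =
      smult 2 (hermite_poly (Suc n)) + [:0, 2:] * smult (2 * of_nat (Suc n)) (hermite_poly n)
      - smult (2 * of_nat (Suc n)) (smult (2 * of_nat n) (hermite_poly (n - 1)))"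
    using 3 by (simp add: pderiv_diff pderiv_mult pderiv_smult pderiv_pCons)
  also have "\<dots> = smult (2 * of_nat (Suc (Suc n))) (hermite_poly (Suc n))"
    unfolding *
    by (simp add: smult_diff_right del: hermite_poly.simps)
       (simp only: flip: smult_add_left, simp add: algebra_simps)
  finally show ?case by simp
qed

text \<open>The raising form of the recurrence: it is what y - d/dy does to a polynomial times
  exp(-y^2/2), and what integration by parts needs.\<close>

lemma hermite_poly_Suc:
  "hermite_poly (Suc n) = [:0, 2:] * hermite_poly n - pderiv (hermite_poly n :: 'a::idom poly)"
  by (cases n) (simp_all add: pderiv_hermite_poly pderiv_1)

lemma poly_hermite_poly_of_real:
  "poly (hermite_poly n) (of_real x :: 'a::{real_algebra_1,idom}) = of_real (poly (hermite_poly n) x)"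
  by (induction n rule: hermite_poly.induct) simp_all

text \<open>The binomial transform turns the Hermite recurrence at x into the one at x + t. Pascal's
  rule yields the term 2t S(n); the absorption identity (n choose j)(n - j) = n (n - 1 choose j)
  collects the lower-order terms into n S(n - 1).\<close>

lemma binomial_shift_rec:
  fixes x t :: "'a::idom" and H :: "nat \<Rightarrow> 'a"
  defines "S \<equiv> \<lambda>k. \<Sum>j\<le>k. of_nat (k choose j) * (2 * t) ^ j * H (k - j)"
  assumes H: "\<And>m. H (Suc m) = 2 * x * H m - 2 * of_nat m * H (m - 1)"
  shows "S (Suc n) = 2 * (x + t) * S n - 2 * of_nat n * S (n - 1)"
proof -
  have "S (Suc n) = H (Suc n) + (\<Sum>j\<le>n. of_nat (Suc n choose Suc j) * (2 * t) ^ Suc j * H (n - j))"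
    unfolding S_def sum.atMost_Suc_shift by simp
  also have "(\<Sum>j\<le>n. of_nat (Suc n choose Suc j) * (2 * t) ^ Suc j * H (n - j))
      = 2 * t * S n + (\<Sum>j\<le>n. of_nat (n choose Suc j) * (2 * t) ^ Suc j * H (n - j))"
    unfolding S_def sum_distrib_left sum.distrib[symmetric]
    by (intro sum.cong refl) (simp add: algebra_simps)
  also have "H (Suc n) + (2 * t * S n + (\<Sum>j\<le>n. of_nat (n choose Suc j) * (2 * t) ^ Suc j * H (n - j)))
      = 2 * t * S n + (\<Sum>j\<le>Suc n. of_nat (n choose j) * (2 * t) ^ j * H (Suc n - j))"
    unfolding sum.atMost_Suc_shift by simp
  also have "(\<Sum>j\<le>Suc n. of_nat (n choose j) * (2 * t) ^ j * H (Suc n - j))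
      = (\<Sum>j\<le>n. of_nat (n choose j) * (2 * t) ^ j * H (Suc (n - j)))"
    unfolding sum.atMost_Suc by (auto simp: Suc_diff_le binomial_eq_0 intro!: sum.cong)
  also have "\<dots> = 2 * x * S n
      - 2 * (\<Sum>j\<le>n. of_nat ((n choose j) * (n - j)) * (2 * t) ^ j * H (n - j - 1))"
    unfolding S_def H sum_distrib_left sum_subtractf[symmetric]
    by (intro sum.cong refl) (simp add: algebra_simps)
  also have "(\<Sum>j\<le>n. of_nat ((n choose j) * (n - j)) * (2 * t) ^ j * H (n - j - 1)) = of_nat n * S (n - 1)"
  proof (cases n)
    case (Suc m)
    have "(Suc m choose j) * (Suc m - j) = Suc m * (m choose j)" for j
      using binomial_absorb_comp[of "Suc m" j] by (simp only: diff_Suc_1 mult.commute)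
    then show ?thesis
      unfolding Suc S_def sum_distrib_left sum.atMost_Suc
      by (simp add: mult.assoc del: of_nat_mult of_nat_Suc) (simp add: algebra_simps)
  qed simp
  finally show ?thesis by (simp add: algebra_simps)
qed

text \<open>Both sides obey the same two-step recurrence with the same initial values.\<close>

lemma poly_hermite_poly_add:
  fixes x t :: "'a::idom"
  shows "poly (hermite_poly k) (x + t) =
    (\<Sum>j\<le>k. of_nat (k choose j) * (2 * t) ^ j * poly (hermite_poly (k - j)) x)"
    (is "_ = ?S k")
proof (induction k rule: hermite_poly.induct)
  case 1
  show ?case by simp
next
  case 2
  show ?case by (simp add: algebra_simps)
next
  case (3 n)
  have "poly (hermite_poly (Suc m)) x
      = 2 * x * poly (hermite_poly m) x - 2 * of_nat m * poly (hermite_poly (m - 1)) x" for m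
    by (cases m) simp_all
  from binomial_shift_rec[of "\<lambda>m. poly (hermite_poly m) x", OF this, of "Suc n" t]
  have "?S (Suc (Suc n)) = 2 * (x + t) * ?S (Suc n) - 2 * of_nat (Suc n) * ?S n"
    by (simp only: diff_Suc_1)
  moreover have "poly (hermite_poly (Suc (Suc n))) (x + t)
      = 2 * (x + t) * poly (hermite_poly (Suc n)) (x + t) - 2 * of_nat (Suc n) * poly (hermite_poly n) (x + t)"
    by (simp add: algebra_simps)
  ultimately show ?case
    by (simp only: "3.IH")
qed

section \<open>Gaussian integrals of polynomials and Hermite orthogonality\<close>

text \<open>Treating the weighted integral as a linear functional on polynomials makes orthogonality
  a purely algebraic computation.\<close>

definition gauss_int :: "real poly \<Rightarrow> real" where
  "gauss_int p = (LINT y|lborel. poly p y * exp (- y\<^sup>2))"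

lemma has_bochner_integral_gauss_even:
  "has_bochner_integral lborel (\<lambda>y::real. y ^ (2 * m) * exp (- y\<^sup>2))
     (sqrt pi * (fact (2 * m) / (2 ^ (2 * m) * fact m)))"
  using has_bochner_integral_even_function[OF gaussian_moment_even_pos[of m]]
  by (simp add: mult.commute)

lemma has_bochner_integral_gauss_odd:
  "has_bochner_integral lborel (\<lambda>y::real. y ^ (2 * m + 1) * exp (- y\<^sup>2)) 0"
  using has_bochner_integral_odd_function[OF gaussian_moment_odd_pos[of m]]
  by (simp add: mult.commute)

lemma integrable_power_gauss: "integrable lborel (\<lambda>y::real. y ^ n * exp (- y\<^sup>2))"
proof (cases "even n")
  case True
  then obtain m where "n = 2 * m" by blast
  then show ?thesis
    using has_bochner_integral_gauss_even[of m] by (simp add: has_bochner_integral_iff)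
next
  case False
  then obtain m where "n = 2 * m + 1" by (rule oddE)
  then show ?thesis
    using has_bochner_integral_gauss_odd[of m] by (simp add: has_bochner_integral_iff)
qed

lemma integrable_poly_gauss: "integrable lborel (\<lambda>y::real. poly p y * exp (- y\<^sup>2))"
  using integrable_power_gauss by (simp add: poly_altdef sum_distrib_right mult.assoc)

lemma gauss_int_add: "gauss_int (p + q) = gauss_int p + gauss_int q"
  unfolding gauss_int_def by (simp add: distrib_right Bochner_Integration.integral_add integrable_poly_gauss)

lemma gauss_int_smult: "gauss_int (smult c p) = c * gauss_int p"
  unfolding gauss_int_def by (simp add: mult.assoc)

lemma gauss_int_0 [simp]: "gauss_int 0 = 0"
  unfolding gauss_int_def by simp

lemma gauss_int_sum: "gauss_int (\<Sum>i\<in>A. f i) = (\<Sum>i\<in>A. gauss_int (f i))"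
  by (induction A rule: infinite_finite_induct) (simp_all add: gauss_int_add)

lemma gauss_int_1: "gauss_int 1 = sqrt pi"
  using has_bochner_integral_gauss_even[of 0]
  unfolding gauss_int_def by (simp add: has_bochner_integral_iff)

text \<open>Integration by parts against exp(-y^2), obtained without boundary terms: the explicit
  moments give it for monomials, and linearity extends it.\<close>

lemma gauss_int_pderiv: "gauss_int (pderiv p) = gauss_int ([:0, 2:] * p)"
proof -
  have ev: "gauss_int (monom 1 (2 * m)) = sqrt pi * (fact (2 * m) / (2 ^ (2 * m) * fact m))" for m
    unfolding gauss_int_def using has_bochner_integral_gauss_even[of m]
    by (simp add: has_bochner_integral_iff poly_monom)
  have od: "gauss_int (monom 1 (2 * m + 1)) = 0" for m
    unfolding gauss_int_def using has_bochner_integral_gauss_odd[of m]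
    by (simp add: has_bochner_integral_iff poly_monom)
  have mon: "real n * gauss_int (monom 1 (n - 1)) = 2 * gauss_int (monom 1 (Suc n))" for n
  proof (cases "even n")
    case True
    then obtain m where m: "n = 2 * m" by blast
    show ?thesis
    proof (cases m)
      case 0
      then show ?thesis using od[of 0] m by simp
    next
      case (Suc l)
      then show ?thesis using od[of l] od[of m] m by simp
    qed
  next
    case False
    then obtain m where m: "n = 2 * m + 1" by (rule oddE)
    have "gauss_int (monom 1 (Suc n)) = gauss_int (monom 1 (2 * Suc m))"
      using m by simp
    also have "\<dots> = sqrt pi * (real ((2 * m + 2) * (2 * m + 1)) * fact (2 * m)
        / (4 * 2 ^ (2 * m) * (real (m + 1) * fact m)))"
      unfolding ev by (simp add: algebra_simps)
    also have "\<dots> = real (2 * m + 1) / 2 * gauss_int (monom 1 (2 * m))"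
      unfolding ev by (simp add: divide_simps) (simp add: algebra_simps)
    finally show ?thesis
      using m by simp
  qed
  have c: "monom c n = smult c (monom 1 n)" for c :: real and n
    by (simp add: smult_monom)
  have "gauss_int (pderiv (monom c n)) = gauss_int ([:0, 2:] * monom c n)" for c n
  proof -
    have "pderiv (monom c n) = smult c (smult (real n) (monom 1 (n - 1)))"
      by (simp add: pderiv_monom smult_monom)
    moreover have "[:0, 2:] * monom c n = smult c (smult 2 (monom 1 (Suc n)))"
      by (simp add: smult_monom monom_Suc)
    ultimately show ?thesis using mon[of n] by (simp only: gauss_int_smult)
  qed
  moreover have "pderiv (\<Sum>i\<in>A. f i) = (\<Sum>i\<in>A. pderiv (f i))" for f :: "nat \<Rightarrow> real poly" and A
    by (induction A rule: infinite_finite_induct) (simp_all add: pderiv_add)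
  ultimately have "gauss_int (pderiv (\<Sum>i\<le>degree p. monom (coeff p i) i))
      = gauss_int ([:0, 2:] * (\<Sum>i\<le>degree p. monom (coeff p i) i))"
    by (simp only: sum_distrib_left gauss_int_sum)
  then show ?thesis by (simp only: poly_as_sum_of_monoms)
qed

text \<open>Under the Gaussian weight, raising the index on one factor is adjoint to differentiating
  the other, which lowers its index.\<close>

lemma gauss_int_hermite_Suc:
  "gauss_int (hermite_poly m * hermite_poly (Suc n))
     = 2 * real m * gauss_int (hermite_poly (m - 1) * hermite_poly n)"
proof -
  let ?H = "hermite_poly :: nat \<Rightarrow> real poly"
  have "[:0, 2:] * (?H m * ?H n) = ?H m * ?H (Suc n) + ?H m * pderiv (?H n)"
    unfolding hermite_poly_Suc by (simp add: algebra_simps)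
  moreover have "pderiv (?H m * ?H n) = ?H m * pderiv (?H n) + smult (2 * real m) (?H (m - 1) * ?H n)"
    by (simp add: pderiv_mult pderiv_hermite_poly[of m] mult.commute)
  ultimately show ?thesis
    using gauss_int_pderiv[of "?H m * ?H n"] by (simp add: gauss_int_add gauss_int_smult)
qed

lemma gauss_int_hermite:
  "gauss_int (hermite_poly m * hermite_poly n) = (if m = n then 2 ^ n * fact n * sqrt pi else 0)"
proof (induction n arbitrary: m)
  case 0
  show ?case
    \<comment> \<open>For m > 0 the roles are exchanged: \<open>hermite_poly 0\<close> is the factor
      differentiated, so the integral vanishes.\<close>
    using gauss_int_hermite_Suc[of 0 "m - 1"] by (cases m) (simp_all add: gauss_int_1)
next
  case (Suc n)
  show ?case
    unfolding gauss_int_hermite_Suc Suc.IH by (cases m) auto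
qed


section \<open>Upper and lower bounds for Laguerre sums\<close>

definition laguerre_sum :: "nat \<Rightarrow> real \<Rightarrow> real" where
  "laguerre_sum k x = (\<Sum>j\<le>k. real (k choose j) * x ^ j / fact j)"

lemma sum_power_div_fact_le_exp:
  fixes x :: real
  assumes "x \<ge> 0"
  shows "(\<Sum>j\<le>k. x ^ j / fact j) \<le> exp x"
proof -
  have "(\<Sum>j\<in>{..k}. inverse (fact j) *\<^sub>R x ^ j) \<le> (\<Sum>j. inverse (fact j) *\<^sub>R x ^ j)"
    using assms by (intro sum_le_suminf summable_exp_generic) auto
  then show ?thesis
    by (simp add: exp_def field_simps)
qed

text \<open>Each term of the binomial expansion of (1 + w)^k is at most the whole; what remains is a
  partial exponential series in y. The factorisation of the argument is left free for later
  choice.\<close>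

lemma laguerre_sum_le:
  assumes "w \<ge> 0" "y \<ge> 0"
  shows "laguerre_sum k (w * y) \<le> (1 + w) ^ k * exp y"
proof -
  have "real (k choose j) * w ^ j \<le> (1 + w) ^ k" if "j \<le> k" for j
  proof -
    have "real (k choose j) * w ^ j \<le> (\<Sum>i\<le>k. real (k choose i) * w ^ i)"
      using that assms by (intro member_le_sum) auto
    then show ?thesis
      using binomial_ring[of w 1 k] by (simp add: add.commute)
  qed
  then have "laguerre_sum k (w * y) \<le> (\<Sum>j\<le>k. (1 + w) ^ k * (y ^ j / fact j))"
    unfolding laguerre_sum_def using assms
    by (intro sum_mono) (auto simp: power_mult_distrib divide_simps mult.assoc[symmetric] intro!: mult_right_mono)
  also have "\<dots> \<le> (1 + w) ^ k * exp y"
    unfolding sum_distrib_left[symmetric] using assms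
    by (intro mult_left_mono sum_power_div_fact_le_exp) auto
  finally show ?thesis .
qed

text \<open>Cauchy--Schwarz, splitting the binomial coefficient \<open>k choose j\<close> as
  \<open>\<surd>((k choose j) / j!) \<cdot> \<surd>((k choose j) j!)\<close> with \<open>(k choose j) j! = k! / (k - j)!\<close>.\<close>
lemma laguerre_sum_ge:
  assumes "p \<ge> 0" "q \<ge> 0"
  shows "(p + q) ^ (2 * k) \<le> laguerre_sum k (p\<^sup>2) * (fact k * exp (q\<^sup>2))"
proof -
  define a where "a j = sqrt (real (k choose j) / fact j) * p ^ j" for j
  define b where "b j = sqrt (real (k choose j) * fact j) * q ^ (k - j)" for j
  have ab: "a j * b j = real (k choose j) * p ^ j * q ^ (k - j)" for j
    by (simp add: a_def b_def real_sqrt_divide real_sqrt_mult)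
  have a2: "(a j)\<^sup>2 = real (k choose j) * (p\<^sup>2) ^ j / fact j" for j
    by (simp add: a_def power_mult_distrib flip: power_mult) (simp add: mult.commute)
  have b2: "(b j)\<^sup>2 = fact k * ((q\<^sup>2) ^ (k - j) / fact (k - j))" if "j \<le> k" for j
  proof -
    have "(b j)\<^sup>2 = (real (k choose j) * fact j) * (q\<^sup>2) ^ (k - j)"
      by (simp add: b_def power_mult_distrib flip: power_mult) (simp add: mult.commute)
    also have "real (k choose j) * fact j = fact k / fact (k - j)"
      using that by (simp add: binomial_fact)
    finally show ?thesis by simp
  qed
  have "(p + q) ^ (2 * k) = (\<Sum>j\<le>k. a j * b j)\<^sup>2"
    unfolding ab using binomial_ring[of p q k] by (simp add: power_mult mult.commute[of 2])
  also have "\<dots> \<le> (\<Sum>j\<le>k. (a j)\<^sup>2) * (\<Sum>j\<le>k. (b j)\<^sup>2)"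
    by (rule Cauchy_Schwarz_ineq_sum)
  also have "(\<Sum>j\<le>k. (a j)\<^sup>2) = laguerre_sum k (p\<^sup>2)"
    by (simp add: a2 laguerre_sum_def)
  also have "(\<Sum>j\<le>k. (b j)\<^sup>2) = fact k * (\<Sum>j\<le>k. (q\<^sup>2) ^ (k - j) / fact (k - j))"
    by (simp add: b2 sum_distrib_left)
  also have "(\<Sum>j\<le>k. (q\<^sup>2) ^ (k - j) / fact (k - j)) = (\<Sum>j\<le>k. (q\<^sup>2) ^ j / fact j)"
    by (rule sum.reindex_bij_witness[of _ "\<lambda>j. k - j" "\<lambda>j. k - j"]) auto
  also have "laguerre_sum k (p\<^sup>2) * (fact k * \<dots>) \<le> laguerre_sum k (p\<^sup>2) * (fact k * exp (q\<^sup>2))"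
    by (intro mult_left_mono sum_power_div_fact_le_exp) (auto simp: laguerre_sum_def intro!: sum_nonneg)
  finally show ?thesis .
qed

text \<open>A Stirling-type bound by induction; the increment reduces to ln((k + 2)/(k + 1)) >= 1/(k
  + 3/2), the midpoint lower bound for the integral of 1/x.\<close>

lemma ln_fact_le: "ln (fact k) \<le> (real k + 1 / 2) * ln (real k + 1) - real k"
proof (induction k)
  case (Suc k)
  have "2 / (2 * real k + 3) \<le> ln (real k + 2) - ln (real k + 1)"
    using ln_inverse_approx_ge[of "real k + 1" "real k + 2"] by (simp add: algebra_simps)
  then have "1 \<le> (real k + 3 / 2) * (ln (real k + 2) - ln (real k + 1))"
    by (simp add: field_simps)
  moreover have "ln (fact (Suc k)) = ln (real k + 1) + ln (fact k)"
    by (simp add: ln_mult add.commute)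
  ultimately show ?case
    using Suc.IH by (simp add: algebra_simps)
qed simp

text \<open>Recentres the Stirling bound at k + 1/2, the \<open>k1\<close> of the theorem. Replacing
  ln(k + 1) by ln(c) costs at most 1/2 in the exponent.\<close>

lemma fact_le_half_shift:
  defines "c \<equiv> \<lambda>k. real k + 1 / 2"
  shows "fact k \<le> exp (1 - c k) * c k ^ k * sqrt (c k)"
proof -
  have c: "c k > 0" by (simp add: c_def)
  have "ln (real k + 1) - ln (c k) = ln ((real k + 1) / c k)"
    using c by (simp add: ln_div)
  also have "\<dots> \<le> (real k + 1) / c k - 1"
    using c by (intro ln_le_minus_one) simp
  also have "\<dots> = 1 / (2 * c k)"
    using c by (simp add: c_def field_simps)
  finally have "c k * (ln (real k + 1) - ln (c k)) \<le> 1 / 2"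
    using c by (simp add: field_simps)
  then have "ln (fact k) \<le> c k * ln (c k) + (1 - c k)"
    using ln_fact_le[of k] by (simp add: c_def algebra_simps)
  also have "\<dots> = ln (exp (1 - c k) * c k ^ k * sqrt (c k))"
    using c by (simp add: ln_mult ln_realpow ln_sqrt) (simp add: c_def algebra_simps)
  finally show ?thesis
    using c by simp
qed

lemma laguerre_bounds:
  fixes k :: nat and u k1 :: real
  assumes k1: "k1 = real k + 1 / 2" and u: "u \<ge> 0"
  defines "a \<equiv> sqrt (2 * k1) * sinh u"
  defines "N \<equiv> exp (a\<^sup>2) * laguerre_sum k (2 * a\<^sup>2)"
  shows "N \<le> exp (k1 * (2 * u + sinh (2 * u))) * exp (- u)" (is ?upper)
    and "exp (k1 * (2 * u + sinh (2 * u))) * exp (- u) * exp (- 1) / sqrt k1 \<le> N" (is ?lower)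
proof -
  have pos: "k1 > 0" using k1 by simp
  have a2: "a\<^sup>2 = 2 * k1 * (sinh u)\<^sup>2"
    using pos by (simp add: a_def power_mult_distrib)
  have sinh: "sinh u = (exp u - exp (- u)) / 2" and cosh: "cosh u = (exp u + exp (- u)) / 2"
    by (simp_all add: sinh_field_def cosh_field_def)
  have e2: "exp (2 * u) = (exp u)\<^sup>2" by (simp add: exp_double)
  have ee: "exp u * exp (- u) = 1" by (simp flip: exp_add)
  have s2: "sinh (2 * u) = 2 * sinh u * cosh u" by (rule sinh_double)
  \<comment> \<open>Since k = k1 - 1/2, this is where the factor exp(-u) in both bounds
    originates.\<close>
  have ek: "exp (2 * u) ^ k = exp (2 * u * k1) * exp (- u)"
    unfolding k1 by (simp flip: exp_of_nat_mult exp_add) (simp add: algebra_simps)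

  \<comment> \<open>Here y is 2a^2/w written without division, so u = 0 needs no separate case. The
    choice 1 + w = exp(2u) makes a^2 + y exactly k1 sinh(2u).\<close>
  define w where "w = exp (2 * u) - 1"
  define y where "y = 2 * k1 * exp (- u) * sinh u"
  have wy: "w * y = 2 * a\<^sup>2"
  proof -
    have "w = 2 * exp u * sinh u"
      unfolding w_def e2 sinh using ee by (simp add: algebra_simps power2_eq_square)
    then have "w * y = 4 * k1 * (exp u * exp (- u)) * (sinh u)\<^sup>2"
      by (simp add: y_def power2_eq_square)
    then show ?thesis by (simp add: a2 ee)
  qed
  have ay: "a\<^sup>2 + y = k1 * sinh (2 * u)"
  proof -
    have "a\<^sup>2 + y = 2 * k1 * sinh u * (sinh u + exp (- u))"
      unfolding a2 y_def by (simp add: power2_eq_square algebra_simps)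
    also have "sinh u + exp (- u) = cosh u"
      unfolding sinh cosh by (simp add: field_simps)
    finally show ?thesis by (simp add: s2)
  qed
  have "N \<le> exp (a\<^sup>2) * ((1 + w) ^ k * exp y)"
    unfolding N_def wy[symmetric] using u pos
    by (intro mult_left_mono laguerre_sum_le) (auto simp: w_def y_def)
  also have "\<dots> = exp (a\<^sup>2 + y) * exp (2 * u) ^ k"
    by (simp add: w_def exp_add)
  also have "\<dots> = exp (k1 * (2 * u + sinh (2 * u))) * exp (- u)"
    unfolding ay ek by (simp add: distrib_left exp_add mult_ac)
  finally show ?upper .

  \<comment> \<open>The Laguerre argument forces p^2 = 2a^2. With this q, (p + q)^2 = k1 exp(2u) and
    a^2 - q^2 = k1 sinh(2u) - k1, so the target exponent reappears up to factors in k1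
    alone.\<close>
  define p where "p = 2 * sqrt k1 * sinh u"
  define q where "q = sqrt k1 * exp (- u)"
  have p2: "p\<^sup>2 = 2 * a\<^sup>2" and q2: "q\<^sup>2 = k1 * (exp (- u))\<^sup>2"
    using pos by (simp_all add: p_def q_def a2 power_mult_distrib)
  have pq: "(p + q) ^ (2 * k) = k1 ^ k * exp (2 * u) ^ k"
  proof -
    have "p + q = sqrt k1 * exp u"
      by (simp add: p_def q_def sinh field_simps)
    then have "(p + q)\<^sup>2 = k1 * exp (2 * u)"
      using pos by (simp add: power_mult_distrib e2)
    then show ?thesis by (simp add: power_mult power_mult_distrib)
  qed
  have aq: "a\<^sup>2 - q\<^sup>2 = k1 * sinh (2 * u) - k1"
  proof -
    have "2 * (sinh u)\<^sup>2 - (exp (- u))\<^sup>2 = 2 * sinh u * cosh u - exp u * exp (- u)"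
      unfolding sinh cosh by (simp add: power2_eq_square field_simps)
    then have "2 * (sinh u)\<^sup>2 - (exp (- u))\<^sup>2 = sinh (2 * u) - 1"
      unfolding ee s2 .
    then have "k1 * (2 * (sinh u)\<^sup>2 - (exp (- u))\<^sup>2) = k1 * (sinh (2 * u) - 1)"
      by simp
    then show ?thesis by (simp add: a2 q2 algebra_simps)
  qed
  have "exp (k1 * (2 * u + sinh (2 * u))) * exp (- u) * exp (- 1) / sqrt k1
      = exp (a\<^sup>2 - q\<^sup>2) * exp (2 * u) ^ k * exp (k1 - 1) / sqrt k1"
    unfolding aq ek by (simp add: algebra_simps flip: exp_add)
  \<comment> \<open>The leftover factors in k1 are arranged into exactly the upper bound for k! in
    the denominator.\<close>
  also have "\<dots> = exp (a\<^sup>2 - q\<^sup>2) * (p + q) ^ (2 * k) / (exp (1 - k1) * k1 ^ k * sqrt k1)"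
    unfolding pq using pos by (simp add: exp_diff divide_simps)
  also have "\<dots> \<le> exp (a\<^sup>2 - q\<^sup>2) * (p + q) ^ (2 * k) / fact k"
    using fact_le_half_shift[of k] pos unfolding k1[symmetric]
    by (intro divide_left_mono) auto
  also have "\<dots> \<le> exp (a\<^sup>2 - q\<^sup>2) * (laguerre_sum k (p\<^sup>2) * (fact k * exp (q\<^sup>2))) / fact k"
    using u pos by (intro divide_right_mono mult_left_mono laguerre_sum_ge) (auto simp: p_def q_def)
  also have "\<dots> = N"
    by (simp add: N_def p2 exp_diff)
  finally show ?lower .
qed


section \<open>Cauchy-Schwarz and the norm of a rank-one operator\<close>

lemma L2_norm_nonneg: "L2_norm f \<ge> 0"
  by (simp add: L2_norm_def)

lemma L2_norm_mult_left: "L2_norm (\<lambda>y. c * f y) = norm c * L2_norm f"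
  by (simp add: L2_norm_def norm_mult power_mult_distrib real_sqrt_mult)

lemma L2_inner_self: "L2_inner f f = of_real ((L2_norm f)\<^sup>2)"
  unfolding L2_inner_def complex_norm_square[symmetric] integral_complex_of_real
  by (simp add: L2_norm_def)

lemma norm_L2_inner_le:
  assumes "f \<in> L2_functions" "g \<in> L2_functions"
  shows "norm (L2_inner f g) \<le> L2_norm f * L2_norm g"
proof (cases "integrable lborel (\<lambda>y. f y * cnj (g y))")
  case True
  have [measurable]: "f \<in> borel_measurable lborel" "g \<in> borel_measurable lborel"
    using assms by (auto simp: L2_functions_def)
  have sq: "(\<integral>\<^sup>+y. (ennreal (norm (h y)))\<^sup>2 \<partial>lborel) = ennreal ((L2_norm h)\<^sup>2)"
    if "h \<in> L2_functions" for h :: "real \<Rightarrow> complex"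
    using that by (simp add: L2_functions_def L2_norm_def ennreal_power nn_integral_eq_integral)
  have "ennreal (norm (L2_inner f g)) \<le> (\<integral>\<^sup>+y. ennreal (norm (f y * cnj (g y))) \<partial>lborel)"
    unfolding L2_inner_def using True by (rule integral_norm_bound_ennreal)
  also have "\<dots> = (\<integral>\<^sup>+y. ennreal (norm (f y)) * ennreal (norm (g y)) \<partial>lborel)"
    by (simp add: norm_mult ennreal_mult)
  finally have "(ennreal (norm (L2_inner f g)))\<^sup>2 \<le> (\<integral>\<^sup>+y. ennreal (norm (f y)) * ennreal (norm (g y)) \<partial>lborel)\<^sup>2"
    by (rule power_mono) simp
  also have "\<dots> \<le> (\<integral>\<^sup>+y. (ennreal (norm (f y)))\<^sup>2 \<partial>lborel) * (\<integral>\<^sup>+y. (ennreal (norm (g y)))\<^sup>2 \<partial>lborel)"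
    by (rule Cauchy_Schwarz_nn_integral) measurable
  also have "\<dots> = ennreal ((L2_norm f * L2_norm g)\<^sup>2)"
    using assms by (simp add: sq ennreal_mult power_mult_distrib)
  finally have "(norm (L2_inner f g))\<^sup>2 \<le> (L2_norm f * L2_norm g)\<^sup>2"
    by (simp add: ennreal_power)
  then show ?thesis
    by (rule power2_le_imp_le) (simp add: L2_norm_nonneg)
next
  case False
  then show ?thesis
    \<comment> \<open>The integral of a non-integrable function is 0 by convention, so the bound is
      trivial here.\<close>
    by (simp add: L2_inner_def not_integrable_integral_eq L2_norm_nonneg)
qed

text \<open>Cauchy-Schwarz bounds every candidate, and equality holds at g divided by its norm, so
  the supremum is a maximum.\<close>

lemma L2_opnorm_rank_one:
  assumes g: "g \<in> L2_functions" and pos: "L2_norm g > 0"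
  shows "L2_opnorm (\<lambda>f y. L2_inner f g * h y) = L2_norm g * L2_norm h"
  unfolding L2_opnorm_def L2_norm_mult_left
proof (rule cSup_eq_maximum)
  define f where "f = (\<lambda>y. of_real (1 / L2_norm g) * g y)"
  have "f \<in> L2_functions"
    using g by (auto simp: f_def L2_functions_def norm_divide power_divide)
  moreover have "L2_norm f = 1"
    unfolding f_def L2_norm_mult_left using pos by (simp add: norm_divide)
  ultimately have f: "f \<in> {f \<in> L2_functions. L2_norm f \<le> 1}" by simp
  have "L2_inner f g = of_real (1 / L2_norm g) * L2_inner g g"
    unfolding L2_inner_def f_def mult.assoc by (rule integral_mult_right_zero)
  then have "norm (L2_inner f g) * L2_norm h = L2_norm g * L2_norm h"
    using pos by (simp add: L2_inner_self norm_mult power2_eq_square)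
  with f show "L2_norm g * L2_norm h
      \<in> (\<lambda>f. norm (L2_inner f g) * L2_norm h) ` {f \<in> L2_functions. L2_norm f \<le> 1}"
    by (metis (no_types, lifting) image_eqI)
next
  fix x assume "x \<in> (\<lambda>f. norm (L2_inner f g) * L2_norm h) ` {f \<in> L2_functions. L2_norm f \<le> 1}"
  then obtain f where f: "f \<in> L2_functions" "L2_norm f \<le> 1" and x: "x = norm (L2_inner f g) * L2_norm h"
    by blast
  then have "norm (L2_inner f g) \<le> L2_norm f * L2_norm g" "L2_norm f * L2_norm g \<le> 1 * L2_norm g"
    using norm_L2_inner_le[OF _ g] pos by (auto intro!: mult_right_mono)
  then show "x \<le> L2_norm g * L2_norm h"
    unfolding x by (intro mult_right_mono L2_norm_nonneg) simp
qed

section \<open>Shifted Hermite functions and the projection norm\<close>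

lemma hermite_fun_eq:
  "hermite_fun k y =
     of_real ((2 ^ k * fact k * sqrt pi) powr (- 1 / 2)) * (poly (hermite_poly k) y * exp (- (y\<^sup>2) / 2))"
proof -
  have "(creation_op ^^ k) (\<lambda>z. exp (- (z\<^sup>2) / 2)) = (\<lambda>z. poly (hermite_poly k) z * exp (- (z\<^sup>2) / 2))"
  proof (induction k)
    case (Suc k)
    have "((\<lambda>z. poly (hermite_poly k) z * exp (- (z\<^sup>2) / 2)) has_field_derivative
        (poly (pderiv (hermite_poly k)) z - z * poly (hermite_poly k) z) * exp (- (z\<^sup>2) / 2)) (at z)" for z :: complex
      by (auto intro!: derivative_eq_intros poly_DERIV simp: algebra_simps)
    note D = DERIV_imp_deriv[OF this]
    show ?case
      unfolding funpow.simps o_apply Suc.IH unfolding creation_op_def D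
      by (simp add: hermite_poly_Suc algebra_simps fun_eq_iff)
  qed simp
  then show ?thesis by (simp add: hermite_fun_def)
qed

lemma cnj_hermite_fun: "cnj (hermite_fun k z) = hermite_fun k (cnj z)"
proof -
  have "cnj (poly (hermite_poly k) z) = poly (hermite_poly k) (cnj z)"
    by (induction k rule: hermite_poly.induct) simp_all
  then show ?thesis by (simp add: hermite_fun_eq exp_cnj)
qed

lemma has_bochner_integral_hermite_shift:
  "has_bochner_integral lborel
     (\<lambda>y::real. (norm (poly (hermite_poly k) (of_real y + \<i> * of_real a)))\<^sup>2 * exp (- y\<^sup>2))
     (2 ^ k * fact k * sqrt pi * laguerre_sum k (2 * a\<^sup>2))"
proof -
  define c where "c j = of_nat (k choose j) * (2 * (\<i> * of_real a)) ^ j" for j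
  let ?H = "hermite_poly :: nat \<Rightarrow> real poly"
  \<comment> \<open>A real polynomial agreeing with the squared modulus on the real line, so that
    \<open>gauss_int\<close> applies. Taking real parts of the coefficients is harmless because the
    double sum is real.\<close>
  define p where "p = (\<Sum>i\<le>k. \<Sum>j\<le>k. smult (Re (c i * cnj (c j))) (?H (k - i) * ?H (k - j)))"
  have norm_eq: "(norm (poly (hermite_poly k) (of_real y + \<i> * of_real a)))\<^sup>2 = poly p y" for y :: real
  proof -
    have "poly (hermite_poly k) (of_real y + \<i> * of_real a) = (\<Sum>j\<le>k. c j * of_real (poly (?H (k - j)) y))"
      unfolding poly_hermite_poly_add c_def poly_hermite_poly_of_real ..
    then have "of_real ((norm (poly (hermite_poly k) (of_real y + \<i> * of_real a)))\<^sup>2)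
        = (\<Sum>i\<le>k. \<Sum>j\<le>k. c i * cnj (c j) * of_real (poly (?H (k - i)) y * poly (?H (k - j)) y))"
      by (simp only: complex_norm_square cnj_sum sum_product) (simp add: mult_ac)
    then have "(norm (poly (hermite_poly k) (of_real y + \<i> * of_real a)))\<^sup>2
        = Re (\<Sum>i\<le>k. \<Sum>j\<le>k. c i * cnj (c j) * of_real (poly (?H (k - i)) y * poly (?H (k - j)) y))"
      by (metis Re_complex_of_real)
    moreover have "Re (z * of_real r) = Re z * r" for z r
      by simp
    ultimately show ?thesis
      by (simp only: p_def poly_sum poly_smult poly_mult Re_sum)
  qed
  have "gauss_int p = (\<Sum>i\<le>k. \<Sum>j\<le>k. Re (c i * cnj (c j)) * (if k - i = k - j then 2 ^ (k - j) * fact (k - j) * sqrt pi else 0))"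
    unfolding p_def gauss_int_sum gauss_int_smult gauss_int_hermite ..
  also have "\<dots> = (\<Sum>i\<le>k. \<Sum>j\<le>k. if i = j then (norm (c i))\<^sup>2 * (2 ^ (k - i) * fact (k - i) * sqrt pi) else 0)"
    \<comment> \<open>As i and j are at most k, \<open>k - i = k - j\<close> means i = j, and only
      diagonal terms survive.\<close>
    by (intro sum.cong refl) (auto simp: cmod_power2, simp add: power2_eq_square)
  also have "\<dots> = (\<Sum>i\<le>k. (norm (c i))\<^sup>2 * (2 ^ (k - i) * fact (k - i) * sqrt pi))"
    by (simp add: sum.delta)
  also have "\<dots> = 2 ^ k * fact k * sqrt pi * laguerre_sum k (2 * a\<^sup>2)"
    unfolding laguerre_sum_def sum_distrib_left
  proof (intro sum.cong refl)
    fix i assume "i \<in> {..k}"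
    then have i: "i \<le> k" by simp
    \<comment> \<open>Only one of the two binomial factors is expanded into factorials; its (k - i)!
      then cancels the one from the Hermite norm.\<close>
    have nc: "(norm (c i))\<^sup>2 = real (k choose i) * (fact k / (fact i * fact (k - i))) * (4 * a\<^sup>2) ^ i"
    proof -
      have "norm (c i) = real (k choose i) * (2 * \<bar>a\<bar>) ^ i"
        by (simp add: c_def norm_mult norm_power)
      moreover have "(x ^ i)\<^sup>2 = (x\<^sup>2) ^ i" for x :: real
        by (simp add: mult.commute flip: power_mult)
      ultimately have "(norm (c i))\<^sup>2 = (real (k choose i))\<^sup>2 * ((2 * \<bar>a\<bar>)\<^sup>2) ^ i"
        by (simp only: power_mult_distrib[of "real (k choose i)"])
      also have "(real (k choose i))\<^sup>2 = real (k choose i) * (fact k / (fact i * fact (k - i)))"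
        using i by (simp add: power2_eq_square binomial_fact)
      finally show ?thesis by (simp add: power_mult_distrib)
    qed
    have two_power: "(2::real) ^ k = 2 ^ (k - i) * 2 ^ i"
      unfolding power_add[symmetric] using i by simp
    have four_power: "(4 * a\<^sup>2) ^ i = 2 ^ i * (2 * a\<^sup>2) ^ i"
      unfolding power_mult_distrib[symmetric] by simp
    show "(norm (c i))\<^sup>2 * (2 ^ (k - i) * fact (k - i) * sqrt pi)
        = 2 ^ k * fact k * sqrt pi * (real (k choose i) * (2 * a\<^sup>2) ^ i / fact i)"
      unfolding nc two_power four_power by simp
  qed
  finally show ?thesis
    unfolding norm_eq gauss_int_def has_bochner_integral_iff using integrable_poly_gauss by simp
qed

lemma has_bochner_integral_hermite_fun_shift:
  "has_bochner_integral lborel (\<lambda>y::real. (norm (hermite_fun k (of_real y + \<i> * of_real a)))\<^sup>2)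
     (exp (a\<^sup>2) * laguerre_sum k (2 * a\<^sup>2))"
proof -
  define C where "C = 2 ^ k * fact k * sqrt pi"
  have C: "C > 0" by (simp add: C_def)
  have "((C powr (- 1 / 2)))\<^sup>2 = 1 / C"
    using C by (simp add: power2_eq_square powr_minus_divide flip: powr_add)
  \<comment> \<open>The real part of -(y + ia)^2 is a^2 - y^2, the source of the factor
    exp(a^2).\<close>
  moreover have "(norm (exp (- ((of_real y + \<i> * of_real a)\<^sup>2) / 2)))\<^sup>2 = exp (a\<^sup>2) * exp (- y\<^sup>2)" for y :: real
    by (simp add: norm_exp_eq_Re power2_eq_square flip: exp_add)
  ultimately have "(norm (hermite_fun k (of_real y + \<i> * of_real a)))\<^sup>2 = exp (a\<^sup>2) / C *
      ((norm (poly (hermite_poly k) (of_real y + \<i> * of_real a)))\<^sup>2 * exp (- y\<^sup>2))" for y :: real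
    unfolding hermite_fun_eq C_def[symmetric] by (simp add: norm_mult power_mult_distrib)
  then show ?thesis
    using has_bochner_integral_mult_right[OF has_bochner_integral_hermite_shift[of k a], of "exp (a\<^sup>2) / C"] C
    by (simp add: C_def[symmetric])
qed

lemma L2_opnorm_shifted_proj:
  "L2_opnorm (shifted_proj a k) = exp (a\<^sup>2) * laguerre_sum k (2 * a\<^sup>2)"
proof -
  define g where "g = (\<lambda>y::real. hermite_fun k (of_real y + \<i> * of_real a))"
  define h where "h = (\<lambda>y::real. hermite_fun k (of_real y - \<i> * of_real a))"
  have int: "has_bochner_integral lborel (\<lambda>y. (norm (g y))\<^sup>2) (exp (a\<^sup>2) * laguerre_sum k (2 * a\<^sup>2))"
    unfolding g_def by (rule has_bochner_integral_hermite_fun_shift)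
  have "continuous_on UNIV g"
    unfolding g_def hermite_fun_eq by (intro continuous_intros) simp
  then have "g \<in> borel_measurable borel"
    by (rule borel_measurable_continuous_onI)
  then have g: "g \<in> L2_functions"
    using int by (simp add: L2_functions_def has_bochner_integral_iff)
  have "h y = cnj (g y)" for y
    unfolding g_def h_def cnj_hermite_fun by simp
  then have hg: "L2_norm h = L2_norm g"
    by (simp add: L2_norm_def)
  \<comment> \<open>The term j = 0 equals 1 and the others are nonnegative.\<close>
  have pos: "laguerre_sum k (2 * a\<^sup>2) > 0"
    unfolding laguerre_sum_def by (rule sum_pos2[of _ 0]) auto
  have sq: "(L2_norm g)\<^sup>2 = exp (a\<^sup>2) * laguerre_sum k (2 * a\<^sup>2)"
    using int pos by (simp add: L2_norm_def has_bochner_integral_iff)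
  then have "L2_norm g > 0"
    using pos L2_norm_nonneg[of g] by (cases "L2_norm g = 0") auto
  then show ?thesis
    using L2_opnorm_rank_one[OF g, of h] hg sq
    unfolding shifted_proj_def g_def h_def by (simp add: power2_eq_square)
qed

section \<open>The error-function constant and the final estimate\<close>

text \<open>The integrand exp(-t^2) is at most 1.\<close>

lemma erf_le:
  assumes "z \<ge> 0"
  shows "sqrt pi * erf z \<le> 2 * z"
proof -
  have int: "set_integrable lborel (einterval 0 z) f" if "continuous_on UNIV f" for f :: "real \<Rightarrow> real"
    using interval_integrable_isCont[of 0 z f] assms that
    by (simp add: interval_lebesgue_integrable_def continuous_on_eq_continuous_at zero_ereal_def)
  have "(LBINT t=0..z. exp (- (t\<^sup>2))) \<le> (LBINT t=0..z. 1)"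
    unfolding interval_lebesgue_integral_le_eq[of 0 "ereal z", simplified, OF assms]
    by (intro set_integral_mono int continuous_intros) auto
  also have "\<dots> = z"
    using interval_integral_const(2)[of 0 z 1] by (simp add: zero_ereal_def)
  finally show ?thesis by (simp add: erf_def)
qed

theorem theorem5p1:
  fixes k :: nat and k1 u C0 :: real
  assumes "k1 = real k + 1 / 2"
    and "u \<ge> 0"
    and "C0 = sqrt pi * erf (pi / 2)"
  shows "C0 / (exp 1 * sqrt (8 * pi * k1)) * exp (- 2 * u)
           \<le> exp (- k1 * (2 * u + sinh (2 * u))) * L2_opnorm (shifted_proj (sqrt (2 * k1) * sinh u) k)
       \<and> exp (- k1 * (2 * u + sinh (2 * u))) * L2_opnorm (shifted_proj (sqrt (2 * k1) * sinh u) k)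
           \<le> sqrt (27 / exp 1)"
proof -
  define E where "E = exp (k1 * (2 * u + sinh (2 * u)))"
  define N where "N = L2_opnorm (shifted_proj (sqrt (2 * k1) * sinh u) k)"
  have E: "exp (- k1 * (2 * u + sinh (2 * u))) = 1 / E"
    by (simp add: E_def exp_minus divide_inverse)
  have "E > 0" by (simp add: E_def)
  note bounds = laguerre_bounds[OF assms(1,2), folded L2_opnorm_shifted_proj, folded N_def E_def]

  have "C0 \<le> sqrt (8 * pi)"
  proof -
    have "C0 \<le> pi" using erf_le[of "pi / 2"] assms(3) by simp
    also have "pi = sqrt (pi * pi)" by simp
    also have "\<dots> \<le> sqrt (8 * pi)"
      using pi_less_4 by (intro real_sqrt_le_mono mult_right_mono) auto
    finally show ?thesis .
  qed
  then have "C0 / (exp 1 * sqrt (8 * pi * k1)) \<le> sqrt (8 * pi) / (exp 1 * sqrt (8 * pi * k1))"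
    using assms(1) by (intro divide_right_mono) auto
  also have "\<dots> = exp (- 1) / sqrt k1"
    unfolding real_sqrt_mult[of "8 * pi" k1] exp_minus by (simp add: divide_inverse)
  \<comment> \<open>Weakens exp(-u) to exp(-2u), using u >= 0.\<close>
  finally have "C0 / (exp 1 * sqrt (8 * pi * k1)) * exp (- 2 * u) \<le> exp (- 1) / sqrt k1 * exp (- u)"
    using assms(1,2) by (intro mult_mono) auto
  also have "\<dots> \<le> 1 / E * N"
    using bounds(2) \<open>E > 0\<close> by (simp add: divide_simps mult_ac)
  finally have lower: "C0 / (exp 1 * sqrt (8 * pi * k1)) * exp (- 2 * u) \<le> 1 / E * N" .

  have "1 / E * N \<le> exp (- u)"
    using bounds(1) \<open>E > 0\<close> by (simp add: divide_simps mult_ac)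
  also have "\<dots> \<le> 1" using assms(2) by simp
  \<comment> \<open>Holds because e <= 3 < 27.\<close>
  also have "1 \<le> sqrt (27 / exp 1)"
    using exp_le by (simp add: divide_simps)
  finally have "1 / E * N \<le> sqrt (27 / exp 1)" .
  with lower show ?thesis
    unfolding E N_def by blast
qed

end
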